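(* Let $\hat{A}$ be the normalized adjacency matrix of the ring of cliques $\mathcal{R}_{b,q}$, and let $n=bq$ be its number of vertices. There is an eigenspace $\mathcal{X}_{noise}$ of $\hat{A}$ of multiplicity $(n-2q)$ associated with the eigenvalue $$\lambda_{noise}=\frac{-1}{b-1}.$$ Any vector that is zero-valued on all corner vertices and sums to zero on each individual set of internal vertices is in $\mathcal{X}_{noise}$.
   Context: The ring of cliques $\mathcal{R}_{b,q}$ (a $q$-ring of $b$-cliques) is the graph parameterized by a block size $b$ and a number of blocks $q$, with $n=bq$ vertices: each of the $q$ blocks is a clique on $b$ vertices. In each block a single vertex, called the corner, is also connected to the corners of the two adjacent cliques, so that the $q$ corners form a ring (cycle); the other $b-1$ vertices of the block are called internal and have no edges leaving the block. "Each individual set of internal vertices" means the set of $b-1$ internal vertices of a single block. The adjacency matrix is $A=I_q\otimes(\mathbf{1}_b\mathbf{1}_b^t-I_b)+C_q\otimes(\mathbf{e}_1\mathbf{e}_1^t)$, where $I_k$ is the $k\times k$ identity, $\mathbf{1}_b\in\mathbb{R}^b$ is the all-ones vector, $\mathbf{e}_1\in\mathbb{R}^b$ has a one in its first entry and zeros elsewhere, and $C_q$ is the adjacency matrix of the cycle graph on $q$ vertices. $D$ is the diagonal matrix with $d_{i,i}=(A\mathbf{1})_i$, where $\mathbf{1}$ is the all-ones vector, and $\hat{A}=D^{-1/2}AD^{-1/2}$. For a symmetric matrix $M\in\mathbb{R}^{n\times n}$, the eigenspace associated with an eigenvalue $\lambda$ is $\{\mathbf{x}\in\mathbb{R}^n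 : M\mathbf{x}=\lambda\mathbf{x}\}$, whose dimension equals the multiplicity of $\lambda$.
   Formalization: For b=3 with 3|q, and b=2 with q even, the full eigenspace is larger than n-2q; there the noise space is only claimed to be a subspace of it, of dimension n-2q. That the value is an eigenvalue is claimed only for b≥3 (for b=2 the space is zero). Assumes b≥2, q≥3. *)

theory Defs
  imports Complex_Main "Jordan_Normal_Form.Char_Poly" "Jordan_Normal_Form.VS_Connect"
begin

definition kronecker :: "real mat \<Rightarrow> real mat \<Rightarrow> real mat" where
  "kronecker A B = mat (dim_row A * dim_row B) (dim_col A * dim_col B)
     (\<lambda>(i, j). A $$ (i div dim_row B, j div dim_col B) * B $$ (i mod dim_row B, j mod dim_col B))"

definition outer_product :: "real vec \<Rightarrow> real vec \<Rightarrow> real mat" where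
  "outer_product v w = mat (dim_vec v) (dim_vec w) (\<lambda>(i, j). v $ i * w $ j)"

definition ones_vec :: "nat \<Rightarrow> real vec" where
  "ones_vec n = vec n (\<lambda>_. 1)"

text \<open>This is the cycle graph only for \<open>q \<ge> 3\<close>.\<close>

definition cycle_adjacency :: "nat \<Rightarrow> real mat" where
  "cycle_adjacency q = mat q q
     (\<lambda>(i, j). of_bool (j = (i + 1) mod q \<or> i = (j + 1) mod q))"

text \<open>
  The vertex at position \<open>j < b\<close> of block \<open>k < q\<close> has index \<open>k * b + j\<close>, as dictated by the
  Kronecker product; position \<open>0\<close> is the corner.
\<close>

definition corner :: "nat \<Rightarrow> nat \<Rightarrow> nat" where
  "corner b k = k * b"

definition internal :: "nat \<Rightarrow> nat \<Rightarrow> nat set" where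
  "internal b k = {k * b + 1..<k * b + b}"

definition roc_adjacency :: "nat \<Rightarrow> nat \<Rightarrow> real mat" where
  "roc_adjacency b q =
     kronecker (1\<^sub>m q) (outer_product (ones_vec b) (ones_vec b) - 1\<^sub>m b)
     + kronecker (cycle_adjacency q) (outer_product (unit_vec b 0) (unit_vec b 0))"

lemma roc_adjacency_carrier [simp]: "roc_adjacency b q \<in> carrier_mat (b * q) (b * q)"
  by (auto simp: roc_adjacency_def kronecker_def outer_product_def ones_vec_def
      cycle_adjacency_def mult.commute)

lemma roc_adjacency_entry:
  assumes "q \<ge> 3" "u < b * q" "v < b * q"
  shows "roc_adjacency b q $$ (u, v) =
    of_bool (u div b = v div b \<and> u \<noteq> v \<or>
      u = corner b (u div b) \<and> v = corner b (v div b) \<and>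
      (v div b = (u div b + 1) mod q \<or> u div b = (v div b + 1) mod q))"
proof -
  have b: "b > 0"
    using assms(2) by (cases b) auto
  have d: "u div b < q" "v div b < q" "u mod b < b" "v mod b < b"
    using assms b by (simp_all add: less_mult_imp_div_less mult.commute)
  have eq: "u = v \<longleftrightarrow> u div b = v div b \<and> u mod b = v mod b"
    by (metis div_mult_mod_eq)
  have c: "u = corner b (u div b) \<longleftrightarrow> u mod b = 0" "v = corner b (v div b) \<longleftrightarrow> v mod b = 0"
    unfolding corner_def by (metis add.right_neutral add_left_cancel div_mult_mod_eq)+
  have ne: "Suc k mod q \<noteq> k" if "k < q" for k
    using that assms(1) by (cases "Suc k = q") auto
  show ?thesis
    using assms b d ne[of "u div b"] ne[of "v div b"]
    unfolding eq c
    by (auto simp: roc_adjacency_def kronecker_def outer_product_def ones_vec_def unit_vec_def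
        cycle_adjacency_def mult.commute)
qed

definition degree_matrix :: "real mat \<Rightarrow> real mat" where
  "degree_matrix A = mat_diag (dim_row A) (\<lambda>i. (A *\<^sub>v ones_vec (dim_col A)) $ i)"

text \<open>\<open>D\<^sup>-\<^sup>1\<^sup>/\<^sup>2\<close> for a diagonal matrix \<open>D\<close> with positive diagonal entries.\<close>

definition diag_inv_sqrt :: "real mat \<Rightarrow> real mat" where
  "diag_inv_sqrt D = mat_diag (dim_row D) (\<lambda>i. 1 / sqrt (D $$ (i, i)))"

definition normalized_adjacency :: "real mat \<Rightarrow> real mat" where
  "normalized_adjacency A =
     diag_inv_sqrt (degree_matrix A) * A * diag_inv_sqrt (degree_matrix A)"

definition eigenspace :: "real mat \<Rightarrow> real \<Rightarrow> real vec set" where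
  "eigenspace M l = {x \<in> carrier_vec (dim_row M). M *\<^sub>v x = l \<cdot>\<^sub>v x}"

abbreviation is_subspace :: "nat \<Rightarrow> real vec set \<Rightarrow> bool" where
  "is_subspace n X \<equiv> subspace class_ring X (module_vec TYPE(real) n)"

definition subspace_dim :: "nat \<Rightarrow> real vec set \<Rightarrow> nat" where
  "subspace_dim n X = vectorspace.dim class_ring ((module_vec TYPE(real) n)\<lparr>carrier := X\<rparr>)"

end

theory Submission
  imports Defs "HOL-Number_Theory.Cong"
begin

text \<open>
  After the substitution \<open>y = D\<^sup>-\<^sup>1\<^sup>/\<^sup>2 x\<close> the eigenvalue equation reads \<open>A y = \<lambda> D y\<close>. At an
  internal vertex it says that \<open>y\<close> sums to zero over the block; given this, at the corners it says
  that the corner values \<open>c\<close> satisfy \<open>c (k + 1) + c (k - 1) = - 2 / (b - 1) * c k\<close> around the ring.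
  Vectors with zero corners and zero internal sums solve both, and form the kernel of a surjection
  onto a space of dimension \<open>2 * q\<close>.

  Conversely, a nonzero periodic solution of the corner recurrence would make \<open>- 2 / (b - 1)\<close> equal
  to twice a cosine of a rational multiple of \<open>2 * pi\<close>. This is excluded in Niven's way: writing the
  coefficient as \<open>a / d\<close> in lowest terms, the recurrence gives
  \<open>d ^ n * (c (k + n) + c (k - n)) = V n * c k\<close> with integers \<open>V n\<close> congruent to \<open>a ^ n\<close> modulo \<open>d\<close>,
  so \<open>n = q\<close> forces \<open>V q = 2 * d ^ q\<close>, which is impossible if \<open>d \<ge> 2\<close>. The case \<open>d = 1\<close> only occurs
  for \<open>b = 2\<close> and \<open>b = 3\<close>, where \<open>V\<close> is periodic with period 2 and 3.
\<close>

section \<open>Periodic solutions of the corner recurrence\<close>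

text \<open>The Lucas sequence with parameters \<open>a\<close> and \<open>d ^ 2\<close>. If
  \<open>a = 2 * d * cos t\<close>, its \<open>n\<close>-th term is
  \<open>2 * d ^ n * cos (n * t)\<close>, so it is a Chebyshev recurrence cleared of
  denominators.\<close>

fun lucas_V :: "int \<Rightarrow> int \<Rightarrow> nat \<Rightarrow> int" where
  "lucas_V a d 0 = 2"
| "lucas_V a d (Suc 0) = a"
| "lucas_V a d (Suc (Suc n)) = a * lucas_V a d (Suc n) - d\<^sup>2 * lucas_V a d n"

text \<open>Modulo \<open>d\<close> the recurrence degenerates to multiplication by
  \<open>a\<close>. Index 0 is excluded because the sequence starts with 2, not with
  \<open>a ^ 0\<close>.\<close>

lemma lucas_V_cong: "n > 0 \<Longrightarrow> [lucas_V a d n = a ^ n] (mod d)"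
proof (induction a d n rule: lucas_V.induct)
  case (3 a d n)
  have "[lucas_V a d (Suc (Suc n)) = a * a ^ Suc n - d\<^sup>2 * lucas_V a d n] (mod d)"
    using 3 by (simp del: power_Suc add: cong_diff cong_mult)
  also have "[a * a ^ Suc n - d\<^sup>2 * lucas_V a d n = a ^ Suc (Suc n)] (mod d)"
    by (simp add: cong_iff_dvd_diff power2_eq_square)
  finally show ?case .
qed auto

text \<open>Equality would make \<open>d\<close> divide \<open>a ^ n\<close>, and coprimality would
  then make \<open>d\<close> a unit.\<close>

lemma lucas_V_neq:
  assumes "coprime a d" "d \<ge> 2" "n > 0"
  shows "lucas_V a d n \<noteq> 2 * d ^ n"
proof
  assume "lucas_V a d n = 2 * d ^ n"
  then have "[2 * d ^ n = a ^ n] (mod d)"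
    using lucas_V_cong[of n a d] assms(3) by simp
  then have "d dvd 2 * d ^ n \<longleftrightarrow> d dvd a ^ n"
    by (rule cong_dvd_iff)
  then have "d dvd a ^ n"
    using assms(3) by (simp add: dvd_power)
  moreover have "coprime (a ^ n) d"
    using assms(1) by simp
  ultimately have "is_unit d"
    by (meson coprime_common_divisor dvd_refl)
  then show False
    using assms(2) by simp
qed

text \<open>The characteristic polynomial is \<open>(t + 1) ^ 2\<close>, with double root
  -1.\<close>

lemma lucas_V_minus_two: "lucas_V (-2) 1 n = 2 * (-1) ^ n"
  by (induction "-2 :: int" "1 :: int" n rule: lucas_V.induct) simp_all

text \<open>The characteristic roots are the primitive cube roots of unity, whose
  \<open>n\<close>-th powers are summed here.\<close>

lemma lucas_V_minus_one: "lucas_V (-1) 1 n = (if 3 dvd n then 2 else -1)"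
proof (induction "-1 :: int" "1 :: int" n rule: lucas_V.induct)
  case (3 n)
  then show ?case
    by (auto; presburger)
qed simp_all

text \<open>The analogue of
  \<open>cos (x + n * t) + cos (x - n * t) = 2 * cos (n * t) * cos x\<close>. The bound
  \<open>n <= k\<close> keeps the subtraction from truncating.\<close>

lemma recurrence_lucas_V:
  fixes e :: "nat \<Rightarrow> real" and a d :: int
  assumes rec: "\<And>k. d * (e (k + 2) + e k) = a * e (k + 1)"
  shows "n \<le> k \<Longrightarrow> d ^ n * (e (k + n) + e (k - n)) = lucas_V a d n * e k"
proof (induction n rule: induct_nat_012)
  case 1
  then show ?case
    using rec[of "k - 1"] by simp
next
  case (ge2 n)
  \<comment> \<open>The recurrence is used twice, centred at \<open>k + n + 1\<close> and at its
    mirror image \<open>k - n - 1\<close>.\<close>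
  have "d * (e (k + n + 2) + e (k + n)) = a * e (k + Suc n)"
    using rec[of "k + n"] by simp
  moreover have "d * (e (k - n) + e (k - n - 2)) = a * e (k - Suc n)"
    using rec[of "k - n - 2"] ge2.prems
    by (metis (no_types, lifting) Nat.add_diff_assoc2 Suc_1 Suc_diff_le Suc_eq_plus1 add_2_eq_Suc'
        diff_Suc_Suc diff_Suc_eq_diff_pred diff_add diff_diff_left le_diff_conv2 Suc_leD)
  ultimately have step: "d * (e (k + n + 2) + e (k - n - 2)) =
      a * (e (k + Suc n) + e (k - Suc n)) - d * (e (k + n) + e (k - n))"
    by (simp add: algebra_simps)
  \<comment> \<open>The pair at distance \<open>n\<close> needs only \<open>d ^ n\<close>, so a
    factor \<open>d ^ 2\<close> is left over; this is the second Lucas parameter.\<close>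
  have "d ^ (n + 2) * (e (k + n + 2) + e (k - n - 2)) =
      d ^ (n + 1) * (d * (e (k + n + 2) + e (k - n - 2)))"
    by simp
  also have "\<dots> = a * (d ^ Suc n * (e (k + Suc n) + e (k - Suc n)))
      - d\<^sup>2 * (d ^ n * (e (k + n) + e (k - n)))"
    unfolding step by (simp add: algebra_simps power2_eq_square)
  also have "\<dots> = a * (lucas_V a d (Suc n) * e k) - d\<^sup>2 * (lucas_V a d n * e k)"
    using ge2 by simp
  finally show ?case
    by (simp add: algebra_simps)
qed simp

text \<open>Unrolled along the ring, \<open>z\<close> becomes a sequence of period \<open>q\<close>,
  and a shift by \<open>q\<close> in either direction returns to the same value. The predecessor is
  written \<open>(k + q - 1) mod q\<close> so that it wraps around at \<open>k = 0\<close>.\<close>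

lemma cycle_recurrence_trivial:
  fixes z :: "nat \<Rightarrow> real" and a d :: int
  assumes rec: "\<And>k. k < q \<Longrightarrow> d * (z ((k + 1) mod q) + z ((k + q - 1) mod q)) = a * z k"
    and neq: "lucas_V a d q \<noteq> 2 * d ^ q" and k: "k < q"
  shows "z k = 0"
proof -
  define e where "e j = z (j mod q)" for j
  have "d * (e (j + 2) + e j) = a * e (j + 1)" for j
  proof -
    define r where "r = (j + 1) mod q"
    have r: "r < q"
      using k by (simp add: r_def)
    have "(r + 1) mod q = (j + 2) mod q"
      by (simp add: r_def mod_simps)
    moreover have "(r + q - 1) mod q = j mod q"
    proof -
      have "(r + q - 1) mod q = (r + (q - 1)) mod q"
        using k by simp
      also have "\<dots> = (j + 1 + (q - 1)) mod q"
        unfolding r_def by (rule mod_add_left_eq)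
      also have "j + 1 + (q - 1) = j + q"
        using k by simp
      finally show ?thesis
        by simp
    qed
    ultimately show ?thesis
      using rec[OF r] by (simp add: e_def r_def)
  qed
  \<comment> \<open>The base point \<open>k + q\<close> leaves room for a step back by
    \<open>q\<close>; both outer terms and the middle one equal \<open>z k\<close>.\<close>
  from recurrence_lucas_V[of d e a q "k + q", OF this]
  have "d ^ q * (2 * z k) = lucas_V a d q * z k"
    using k by (simp add: e_def flip: mult_2 add.assoc)
  then have "real_of_int (2 * d ^ q - lucas_V a d q) * z k = 0"
    by (simp add: algebra_simps)
  then show ?thesis
    using neq by (metis eq_iff_diff_eq_0 mult_eq_0_iff of_int_eq_0_iff)
qed

text \<open>In the excluded cases nonzero solutions exist: for \<open>b = 2\<close> the coefficient
  is -2 and alternating signs fit an even ring; for \<open>b = 3\<close> it is -1 and any 3-periodic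
  sequence with zero sum over a period fits.\<close>

lemma corner_recurrence_trivial:
  fixes z :: "nat \<Rightarrow> real"
  assumes "b \<ge> 2" and "q > 0" and "\<not> (b = 2 \<and> even q)" and "\<not> (b = 3 \<and> 3 dvd q)"
    and rec: "\<And>k. k < q \<Longrightarrow>
      z ((k + 1) mod q) + z ((k + q - 1) mod q) = - 2 / (real b - 1) * z k"
    and k: "k < q"
  shows "z k = 0"
proof -
  define m where "m = int b - 1"
  have m: "m \<ge> 1" "real b - 1 = real_of_int m"
    using assms(1) by (simp_all add: m_def)
  \<comment> \<open>\<open>a / d\<close> is the recurrence coefficient \<open>- 2 / m\<close> in
    lowest terms.\<close>
  obtain a d where ad: "a * m = - 2 * d" "d > 0" "lucas_V a d q \<noteq> 2 * d ^ q"
  proof -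
    consider "m = 1" | "m = 2" | "m \<ge> 3"
      using m by linarith
    then show thesis
    proof cases
      case 1
      then have "odd q"
        using assms(3) by (simp add: m_def)
      then show thesis
        using 1 by (intro that[of "-2" 1]) (simp_all add: lucas_V_minus_two)
    next
      case 2
      then have "\<not> 3 dvd q"
        using assms(4) by (simp add: m_def)
      then show thesis
        using 2 by (intro that[of "-1" 1]) (simp_all add: lucas_V_minus_one)
    next
      case 3
      define g where "g = gcd (-2) m"
      obtain a d where *: "-2 = a * g" "m = d * g" "coprime a d"
        using gcd_coprime_exists[of "-2" m] 3 unfolding g_def by auto
      have g: "g > 0"
        using 3 by (simp add: g_def)
      have "d > 0"
        using * g 3 by (metis zero_less_mult_pos2 zero_less_one order_less_le_trans zero_less_numeral)
      \<comment> \<open>Since \<open>g\<close> divides 2 and \<open>m = d * g\<close> is at least 3,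
        \<open>d\<close> cannot be 1.\<close>
      moreover have "g \<le> 2"
        unfolding g_def by (rule zdvd_imp_le) simp_all
      then have "d \<noteq> 1"
        using * 3 by auto
      ultimately have d: "d \<ge> 2"
        by simp
      have "a * m = - 2 * d"
        using * by (metis mult.assoc mult.commute)
      then show thesis
        using that lucas_V_neq[OF *(3) d \<open>q > 0\<close>] d by simp
    qed
  qed
  have "d * (z ((k + 1) mod q) + z ((k + q - 1) mod q)) = a * z k" if "k < q" for k
  proof -
    have "real_of_int a * real_of_int m = - 2 * real_of_int d"
      using ad(1) by (metis of_int_minus of_int_mult of_int_numeral)
    then have "real_of_int d * (- 2 / real_of_int m) = a"
      using m(1) by (simp add: field_simps)
    then show ?thesis
      unfolding rec[OF that] m by (metis mult.assoc)
  qed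
  from cycle_recurrence_trivial[OF this ad(3) k] show ?thesis .
qed

section \<open>The eigenvalue equation\<close>

lemma sum_blocks:
  fixes f :: "nat \<Rightarrow> 'a :: comm_monoid_add"
  shows "(\<Sum>v<b * q. f v) = (\<Sum>k<q. \<Sum>j<b. f (k * b + j))"
proof -
  have "(\<Sum>v<b * q. f v) = (\<Sum>k<q. sum f {k * b..<k * b + b})"
    by (simp add: sum.nat_group mult.commute)
  moreover have "sum f {k * b..<k * b + b} = (\<Sum>j<b. f (k * b + j))" for k
    using sum.shift_bounds_nat_ivl[of f 0 "k * b" b]
    by (simp add: add.commute lessThan_atLeast0)
  ultimately show ?thesis
    by simp
qed

lemma cycle_sum:
  fixes z :: "nat \<Rightarrow> real"
  assumes "q \<ge> 3" "k < q"
  shows "(\<Sum>l<q. cycle_adjacency q $$ (k, l) * z l) = z ((k + 1) mod q) + z ((k + q - 1) mod q)"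
proof -
  let ?s = "(k + 1) mod q" and ?p = "(k + q - 1) mod q"
  have p: "k = (l + 1) mod q \<longleftrightarrow> l = ?p" if "l < q" for l
    using assms that by (cases "Suc l = q"; cases "k = 0") (auto simp: mod_if)
  \<comment> \<open>Here \<open>q >= 3\<close> matters: coinciding neighbours would be counted twice
    on the right but only once by the matrix entry.\<close>
  have "?s \<noteq> ?p"
    using assms by (cases "Suc k = q"; cases "k = 0") (auto simp: mod_if)
  then have "(\<Sum>l<q. cycle_adjacency q $$ (k, l) * z l) =
      (\<Sum>l<q. (if l = ?s then z l else 0) + (if l = ?p then z l else 0))"
    using assms p by (intro sum.cong) (auto simp: cycle_adjacency_def)
  also have "\<dots> = z ?s + z ?p"
    using assms by (simp add: sum.distrib)
  finally show ?thesis .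
qed

lemma block_index:
  fixes b q :: nat
  assumes "k < q" "i < b"
  shows "k * b + i < b * q" "(k * b + i) div b = k" "(k * b + i) mod b = i"
proof -
  have "k * b + i < Suc k * b"
    using assms by simp
  also have "\<dots> \<le> q * b"
    using assms by (intro mult_le_mono1) simp
  finally show "k * b + i < b * q"
    by (simp add: mult.commute)
qed (use assms in simp_all)

lemma block_indexE:
  fixes b q :: nat
  assumes "u < b * q"
  obtains k i where "k < q" "i < b" "u = k * b + i"
proof
  show "u div b < q"
    using assms by (simp add: less_mult_imp_div_less mult.commute)
  show "u mod b < b"
    using assms by (cases b) auto
  show "u = u div b * b + u mod b"
    by simp
qed

text \<open>The two Kronecker summands act separately: the clique part stays within the block, and
  the ring part links position 0 of a block only to position 0 of its neighbours.\<close>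

lemma roc_adjacency_mult:
  assumes "q \<ge> 3" "k < q" "i < b" and x: "x \<in> carrier_vec (b * q)"
  shows "(roc_adjacency b q *\<^sub>v x) $ (k * b + i) = (\<Sum>j<b. x $ (k * b + j)) - x $ (k * b + i)
    + (if i = 0 then x $ corner b ((k + 1) mod q) + x $ corner b ((k + q - 1) mod q) else 0)"
proof -
  let ?c = "\<lambda>l. cycle_adjacency q $$ (k, l)"
  have entry: "roc_adjacency b q $$ (k * b + i, l * b + j) =
      (if l = k then 1 - of_bool (j = i) else 0) + (if i = 0 \<and> j = 0 then ?c l else 0)"
    if "l < q" "j < b" for l j
    using assms that block_index[OF assms(2,3)] block_index[OF that]
    by (auto simp: roc_adjacency_def kronecker_def outer_product_def ones_vec_def unit_vec_def
        cycle_adjacency_def mult.commute)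
  have "(roc_adjacency b q *\<^sub>v x) $ (k * b + i) =
      (\<Sum>v<b * q. roc_adjacency b q $$ (k * b + i, v) * x $ v)"
    using block_index(1)[OF assms(2,3)] x
      carrier_matD[OF roc_adjacency_carrier, of b q]
    by (simp add: scalar_prod_def row_def lessThan_atLeast0)
  also have "\<dots> = (\<Sum>l<q. \<Sum>j<b. ((if l = k then 1 - of_bool (j = i) else 0)
      + (if i = 0 \<and> j = 0 then ?c l else 0)) * x $ (l * b + j))"
    unfolding sum_blocks by (intro sum.cong refl) (simp add: entry)
  also have "\<dots> = (\<Sum>l<q. \<Sum>j<b. (if l = k then 1 - of_bool (j = i) else 0) * x $ (l * b + j))
      + (\<Sum>l<q. \<Sum>j<b. (if i = 0 \<and> j = 0 then ?c l else 0) * x $ (l * b + j))"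
    by (simp only: distrib_right sum.distrib)
  also have "(\<Sum>l<q. \<Sum>j<b. (if l = k then 1 - of_bool (j = i) else 0) * x $ (l * b + j)) =
      (\<Sum>l<q. if l = k then \<Sum>j<b. (1 - of_bool (j = i)) * x $ (k * b + j) else 0)"
    by (intro sum.cong refl) simp
  also have "(\<Sum>l<q. \<Sum>j<b. (if i = 0 \<and> j = 0 then ?c l else 0) * x $ (l * b + j)) =
      (\<Sum>l<q. \<Sum>j<b. (if j = 0 then if i = 0 then ?c l * x $ (l * b) else 0 else 0))"
    by (intro sum.cong refl) simp
  also have "(\<Sum>l<q. if l = k then \<Sum>j<b. (1 - of_bool (j = i)) * x $ (k * b + j) else 0) =
      (\<Sum>j<b. x $ (k * b + j) - (if j = i then x $ (k * b + j) else 0))"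
    using assms by (auto intro!: sum.cong)
  also have "\<dots> = (\<Sum>j<b. x $ (k * b + j)) - x $ (k * b + i)"
    using assms by (simp add: sum_subtractf)
  also have "(\<Sum>l<q. \<Sum>j<b. (if j = 0 then if i = 0 then ?c l * x $ (l * b) else 0 else 0)) =
      (if i = 0 then \<Sum>l<q. ?c l * x $ (l * b) else 0)"
    using assms by simp
  finally show ?thesis
    using cycle_sum[OF assms(1,2), of "\<lambda>l. x $ (l * b)"] by (simp add: corner_def)
qed

section \<open>Degrees and the passage to block equations\<close>

lemma ones_vec_carrier [simp]: "ones_vec n \<in> carrier_vec n"
  by (simp add: ones_vec_def)

lemma roc_degree:
  assumes "q \<ge> 3" "k < q" "i < b"
  shows "(roc_adjacency b q *\<^sub>v ones_vec (b * q)) $ (k * b + i) =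
    real b - 1 + (if i = 0 then 2 else 0)"
proof -
  have one: "ones_vec (b * q) $ (l * b + j) = 1" if "l < q" "j < b" for l j
    using block_index[OF that] by (simp add: ones_vec_def)
  have "ones_vec (b * q) $ corner b (l mod q) = 1" for l
    using one[of "l mod q" 0] assms by (simp add: corner_def)
  then show ?thesis
    using assms by (simp add: roc_adjacency_mult one)
qed

text \<open>Each row is multiplied by the square root of its degree, which is invertible because
  degrees are positive. This turns the normalized problem into a generalized one without square
  roots.\<close>

lemma eigenspace_normalized_adjacency:
  assumes A: "A \<in> carrier_mat n n"
    and pos: "\<And>u. u < n \<Longrightarrow> (A *\<^sub>v ones_vec n) $ u > 0"
    and x: "x \<in> carrier_vec n"
    and y: "y = vec n (\<lambda>u. x $ u / sqrt ((A *\<^sub>v ones_vec n) $ u))"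
  shows "x \<in> eigenspace (normalized_adjacency A) l \<longleftrightarrow>
    (\<forall>u<n. (A *\<^sub>v y) $ u = l * (A *\<^sub>v ones_vec n) $ u * y $ u)"
proof -
  define f where "f u = 1 / sqrt ((A *\<^sub>v ones_vec n) $ u)" for u
  define D where "D = diag_inv_sqrt (degree_matrix A)"
  have D: "D = mat_diag n f"
    unfolding D_def diag_inv_sqrt_def degree_matrix_def f_def
    using A by (auto simp: mat_diag_def)
  then have Dc: "D \<in> carrier_mat n n"
    by simp
  have Dv: "D *\<^sub>v v = vec n (\<lambda>u. f u * v $ u)" if "v \<in> carrier_vec n" for v
  proof (rule eq_vecI)
    fix u assume "u < dim_vec (vec n (\<lambda>u. f u * v $ u))"
    then have u: "u < n" by simp
    have "(D *\<^sub>v v) $ u = (\<Sum>j\<in>{0..<n}. (if u = j then f j else 0) * v $ j)"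
      using that u by (simp add: D mat_diag_def scalar_prod_def)
    also have "\<dots> = (\<Sum>j\<in>{0..<n}. (if j = u then f u * v $ u else 0))"
      by (intro sum.cong) auto
    finally show "(D *\<^sub>v v) $ u = vec n (\<lambda>u. f u * v $ u) $ u"
      using u by simp
  qed (use Dc in simp)
  have "normalized_adjacency A *\<^sub>v x = D *\<^sub>v (A *\<^sub>v (D *\<^sub>v x))"
    unfolding normalized_adjacency_def D_def[symmetric]
    using A Dc x by (simp add: assoc_mult_mat_vec[of _ n n _ n])
  also have "D *\<^sub>v x = y"
    using Dv[OF x] by (simp add: y f_def)
  also have "D *\<^sub>v (A *\<^sub>v y) = vec n (\<lambda>u. f u * (A *\<^sub>v y) $ u)"
    using A by (intro Dv) (simp add: y)
  finally have N: "normalized_adjacency A *\<^sub>v x = vec n (\<lambda>u. f u * (A *\<^sub>v y) $ u)" .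
  have dim: "dim_row (normalized_adjacency A) = n"
    using Dc by (simp add: normalized_adjacency_def D_def)
  have "f u * (A *\<^sub>v y) $ u = l * x $ u \<longleftrightarrow>
      (A *\<^sub>v y) $ u = l * (A *\<^sub>v ones_vec n) $ u * y $ u" if "u < n" for u
  proof -
    define s where "s = sqrt ((A *\<^sub>v ones_vec n) $ u)"
    have "s > 0" "(A *\<^sub>v ones_vec n) $ u = s * s"
      using pos[OF that] by (simp_all add: s_def)
    moreover have "f u = 1 / s" "y $ u = x $ u / s"
      using that by (simp_all add: f_def y s_def)
    ultimately show ?thesis
      by (simp add: divide_eq_eq mult_ac)
  qed
  then show ?thesis
    using x by (auto simp: eigenspace_def dim N vec_eq_iff)
qed

text \<open>The weights \<open>r\<close> and \<open>s\<close> are the entries of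
  \<open>D^(-1/2)\<close> at corners, of degree \<open>b + 1\<close>, and at internal vertices, of
  degree \<open>b - 1\<close>.\<close>

lemma roc_eigenspace_iff:
  fixes b q :: nat and x :: "real vec"
  assumes b: "b \<ge> 2" and q: "q \<ge> 3" and x: "x \<in> carrier_vec (b * q)"
  defines "r \<equiv> 1 / sqrt (real b + 1)" and "s \<equiv> 1 / sqrt (real b - 1)"
  shows "x \<in> eigenspace (normalized_adjacency (roc_adjacency b q)) (- 1 / (real b - 1)) \<longleftrightarrow>
    (\<forall>k<q. r * x $ corner b k + s * (\<Sum>i\<in>internal b k. x $ i) = 0 \<and>
      x $ corner b ((k + 1) mod q) + x $ corner b ((k + q - 1) mod q) =
        - 2 / (real b - 1) * x $ corner b k)"
    (is "?L \<longleftrightarrow> ?R")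
proof -
  let ?A = "roc_adjacency b q"
  let ?d = "\<lambda>u. (?A *\<^sub>v ones_vec (b * q)) $ u"
  let ?l = "- 1 / (real b - 1)"
  define y where "y = vec (b * q) (\<lambda>u. x $ u / sqrt (?d u))"
  define S where "S k = (\<Sum>j<b. y $ (k * b + j))" for k
  define N where "N k = y $ corner b ((k + 1) mod q) + y $ corner b ((k + q - 1) mod q)" for k
  have y: "y \<in> carrier_vec (b * q)"
    by (simp add: y_def)
  have b1: "real b - 1 > 0"
    using b by simp
  have r: "r > 0"
    by (simp add: r_def)
  have y_eq: "y $ (k * b + i) = (if i = 0 then r else s) * x $ (k * b + i)"
    if "k < q" "i < b" for k i
    using block_index[OF that] roc_degree[OF q that] by (simp add: y_def r_def s_def add.commute)
  have y_corner: "y $ corner b k = r * x $ corner b k" if "k < q" for k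
    using y_eq[OF that, of 0] b by (simp add: corner_def)
  have S: "S k = r * x $ corner b k + s * (\<Sum>i\<in>internal b k. x $ i)" if "k < q" for k
  proof -
    have "{..<b} = insert 0 {1..<b}"
      using b by auto
    then have "S k = y $ (k * b) + (\<Sum>j\<in>{1..<b}. y $ (k * b + j))"
      by (simp add: S_def)
    also have "\<dots> = r * x $ (k * b) + s * (\<Sum>j\<in>{1..<b}. x $ (k * b + j))"
      using y_eq[OF that] y_eq[OF that, of 0] b by (simp add: sum_distrib_left)
    also have "(\<Sum>j\<in>{1..<b}. x $ (k * b + j)) = (\<Sum>i\<in>internal b k. x $ i)"
      using sum.shift_bounds_nat_ivl[of "\<lambda>i. x $ i" 1 "k * b" b]
      by (simp add: internal_def add.commute)
    finally show ?thesis
      by (simp add: corner_def)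
  qed
  have N: "N k = r * (x $ corner b ((k + 1) mod q) + x $ corner b ((k + q - 1) mod q))" for k
    using q by (simp add: N_def y_corner algebra_simps)
  have "?L \<longleftrightarrow> (\<forall>u<b * q. (?A *\<^sub>v y) $ u = ?l * ?d u * y $ u)"
  proof (rule eigenspace_normalized_adjacency[OF _ _ x y_def])
    fix u assume "u < b * q"
    then show "?d u > 0"
      using roc_degree[OF q] b1 by (elim block_indexE) auto
  qed simp
  also have "\<dots> \<longleftrightarrow> (\<forall>k<q. \<forall>i<b.
      (?A *\<^sub>v y) $ (k * b + i) = ?l * ?d (k * b + i) * y $ (k * b + i))"
    using block_index(1) by (metis block_indexE)
  also have "\<dots> \<longleftrightarrow> (\<forall>k<q. \<forall>i<b. if i = 0
      then S k + N k = - 2 / (real b - 1) * y $ corner b k else S k = 0)"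
  proof -
    \<comment> \<open>At an internal vertex the degree cancels the denominator of the eigenvalue,
      and the vertex's own entry drops out. At a corner
      \<open>1 - (b + 1) / (b - 1) = - 2 / (b - 1)\<close> remains.\<close>
    have "(?A *\<^sub>v y) $ (k * b + i) = ?l * ?d (k * b + i) * y $ (k * b + i) \<longleftrightarrow>
        (if i = 0 then S k + N k = - 2 / (real b - 1) * y $ corner b k else S k = 0)"
      if "k < q" "i < b" for k i
      unfolding roc_adjacency_mult[OF q that y] roc_degree[OF q that] S_def[symmetric] N_def[symmetric]
      using b1 by (auto simp: field_simps corner_def)
    then show ?thesis
      by simp
  qed
  also have "\<dots> \<longleftrightarrow> (\<forall>k<q. S k = 0 \<and> N k = - 2 / (real b - 1) * y $ corner b k)"
  proof -
    \<comment> \<open>Position 1 exists because \<open>b >= 2\<close>, so every block contributes an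
      internal equation, which then removes \<open>S k\<close> from the corner equation.\<close>
    have "(\<forall>i<b. if i = 0 then P else Q) \<longleftrightarrow> P \<and> Q" for P Q
    proof
      assume *: "\<forall>i<b. if i = 0 then P else Q"
      then show "P \<and> Q"
        using *[rule_format, of 0] *[rule_format, of 1] b by simp
    qed simp
    then show ?thesis
      by (simp add: conj_commute cong: conj_cong)
  qed
  also have "\<dots> \<longleftrightarrow> ?R"
  proof -
    have "N k = - 2 / (real b - 1) * y $ corner b k \<longleftrightarrow>
        x $ corner b ((k + 1) mod q) + x $ corner b ((k + q - 1) mod q) =
          - 2 / (real b - 1) * x $ corner b k" if "k < q" for k
    proof -
      \<comment> \<open>All corners share the scaling factor \<open>r\<close>, so the recurrence
        passes from \<open>y\<close> to \<open>x\<close>.\<close>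
      have "- 2 / (real b - 1) * y $ corner b k = r * (- 2 / (real b - 1) * x $ corner b k)"
        using y_corner[OF that] by simp
      then show ?thesis
        unfolding N using r by (metis mult_left_cancel less_irrefl)
    qed
    then show ?thesis
      using S by auto
  qed
  finally show ?thesis .
qed

section \<open>The noise space\<close>

definition noise_space :: "nat \<Rightarrow> nat \<Rightarrow> real vec set" where
  "noise_space b q = {x \<in> carrier_vec (b * q).
     \<forall>k<q. x $ corner b k = 0 \<and> (\<Sum>i\<in>internal b k. x $ i) = 0}"

text \<open>The constraints of \<open>noise_space\<close> packed into one linear map, so that the
  noise space is its kernel: corners fill the first \<open>q\<close> coordinates, internal sums the
  last \<open>q\<close>.\<close>

definition block_data :: "nat \<Rightarrow> nat \<Rightarrow> real vec \<Rightarrow> real vec" where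
  "block_data b q x = vec (2 * q)
     (\<lambda>k. if k < q then x $ corner b k else \<Sum>i\<in>internal b (k - q). x $ i)"

lemma corner_less: "b > 0 \<Longrightarrow> k < q \<Longrightarrow> corner b k < b * q"
  using block_index(1)[of k q 0 b] by (simp add: corner_def)

lemma internal_less: "k < q \<Longrightarrow> i \<in> internal b k \<Longrightarrow> i < b * q"
  using block_index(1)[of k q "i - k * b" b] by (auto simp: internal_def)

lemma block_data_surj:
  assumes "b \<ge> 2" and w: "w \<in> carrier_vec (2 * q)"
  shows "\<exists>x\<in>carrier_vec (b * q). block_data b q x = w"
proof
  \<comment> \<open>The preimage puts each prescribed internal sum entirely on position 1, which is
    internal because \<open>b >= 2\<close>.\<close>
  define x where "x = vec (b * q) (\<lambda>u. if u mod b = 0 then w $ (u div b)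
    else if u mod b = 1 then w $ (q + u div b) else 0)"
  show "x \<in> carrier_vec (b * q)"
    by (simp add: x_def)
  have x: "x $ (k * b + i) = (if i = 0 then w $ k else if i = 1 then w $ (q + k) else 0)"
    if "k < q" "i < b" for k i
    unfolding x_def index_vec[OF block_index(1)[OF that]] block_index(2,3)[OF that] ..
  have "(\<Sum>i\<in>internal b k. x $ i) = w $ (q + k)" if "k < q" for k
  proof -
    have "(\<Sum>i\<in>internal b k. x $ i) = (\<Sum>i\<in>{1..<b}. x $ (k * b + i))"
      using sum.shift_bounds_nat_ivl[of "\<lambda>i. x $ i" 1 "k * b" b]
      by (simp add: internal_def add.commute)
    also have "\<dots> = (\<Sum>i\<in>{1..<b}. if i = 1 then w $ (q + k) else 0)"
      using x[OF that] by (intro sum.cong) auto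
    finally show ?thesis
      using assms by simp
  qed
  moreover have "x $ corner b k = w $ k" if "k < q" for k
    using x[OF that, of 0] assms by (simp add: corner_def)
  ultimately show "block_data b q x = w"
    using w by (intro eq_vecI) (auto simp: block_data_def)
qed

lemma linear_map_block_data:
  assumes "b > 0"
  shows "linear_map class_ring (module_vec TYPE(real) (b * q)) (module_vec TYPE(real) (2 * q))
    (block_data b q)"
proof -
  interpret V: vec_space "TYPE(real)" "b * q" .
  interpret W: vec_space "TYPE(real)" "2 * q" .
  have corner: "corner b k < b * q" if "k < q" for k
    using assms that by (rule corner_less)
  have internal: "i < b * q" if "i \<in> internal b (k - q)" "k < 2 * q" "\<not> k < q" for i k
    using that by (intro internal_less[of "k - q"]) auto
  have "block_data b q (x + y) = block_data b q x + block_data b q y"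
    if "x \<in> carrier_vec (b * q)" "y \<in> carrier_vec (b * q)" for x y
  proof (rule eq_vecI)
    fix k assume "k < dim_vec (block_data b q x + block_data b q y)"
    then have k: "k < 2 * q"
      by (simp add: block_data_def)
    have "(\<Sum>i\<in>internal b (k - q). (x + y) $ i) = (\<Sum>i\<in>internal b (k - q). x $ i + y $ i)"
      if "\<not> k < q"
      using internal[OF _ k that] \<open>y \<in> _\<close> by (intro sum.cong refl index_add_vec(1)) simp
    then show "block_data b q (x + y) $ k = (block_data b q x + block_data b q y) $ k"
      using k corner[of k] \<open>y \<in> _\<close> by (simp add: block_data_def sum.distrib)
  qed (simp add: block_data_def)
  moreover have "block_data b q (c \<cdot>\<^sub>v x) = c \<cdot>\<^sub>v block_data b q x"
    if "x \<in> carrier_vec (b * q)" for c x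
  proof (rule eq_vecI)
    fix k assume "k < dim_vec (c \<cdot>\<^sub>v block_data b q x)"
    then have k: "k < 2 * q"
      by (simp add: block_data_def)
    have "(\<Sum>i\<in>internal b (k - q). (c \<cdot>\<^sub>v x) $ i) = (\<Sum>i\<in>internal b (k - q). c * x $ i)"
      if "\<not> k < q"
      using internal[OF _ k that] \<open>x \<in> _\<close> by (intro sum.cong refl index_smult_vec(1)) simp
    then show "block_data b q (c \<cdot>\<^sub>v x) $ k = (c \<cdot>\<^sub>v block_data b q x) $ k"
      using k corner[of k] \<open>x \<in> _\<close> by (simp add: block_data_def sum_distrib_left)
  qed (simp add: block_data_def)
  ultimately show ?thesis
    by unfold_locales (auto simp: module_hom_def module_vec_simps block_data_def)
qed

lemma noise_space_subspace_dim:
  assumes "b \<ge> 2"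
  shows "is_subspace (b * q) (noise_space b q)"
    and "subspace_dim (b * q) (noise_space b q) = b * q - 2 * q"
proof -
  interpret V: vec_space "TYPE(real)" "b * q" .
  interpret W: vec_space "TYPE(real)" "2 * q" .
  interpret linear_map class_ring V.V W.V "block_data b q"
    using assms by (intro linear_map_block_data) simp
  have ker: "kerT = noise_space b q"
  proof -
    have "block_data b q x = 0\<^sub>v (2 * q) \<longleftrightarrow>
        (\<forall>k<q. x $ corner b k = 0 \<and> (\<Sum>i\<in>internal b k. x $ i) = 0)" for x
    proof
      assume *: "block_data b q x = 0\<^sub>v (2 * q)"
      have "x $ corner b k = 0 \<and> (\<Sum>i\<in>internal b k. x $ i) = 0" if "k < q" for k
        using arg_cong[OF *, of "\<lambda>v. v $ k"] arg_cong[OF *, of "\<lambda>v. v $ (q + k)"] that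
        by (simp add: block_data_def)
      then show "\<forall>k<q. x $ corner b k = 0 \<and> (\<Sum>i\<in>internal b k. x $ i) = 0"
        by blast
    qed (auto simp: block_data_def intro!: eq_vecI)
    then show ?thesis
      unfolding ker_def noise_space_def by (simp add: module_vec_simps)
  qed
  show "is_subspace (b * q) (noise_space b q)"
    using kerT_is_subspace ker by simp
  have "imT = carrier W.V"
    using block_data_surj[OF assms] T_im unfolding im_def by (auto simp: module_vec_simps)
  \<comment> \<open>The image enters rank-nullity as the codomain with its carrier replaced; by
    surjectivity this is the codomain itself.\<close>
  moreover have "M\<lparr>carrier := carrier M\<rparr> = M" for M :: "(real, real vec) module"
    by simp
  ultimately have "W.vs imT = W.V"
    by metis
  \<comment> \<open>The additive form also ensures that the subtraction \<open>b * q - 2 * q\<close>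
    does not truncate.\<close>
  then have "W.dim + subspace_dim (b * q) kerT = V.dim"
    using rank_nullity[OF V.fin_dim] by (simp add: subspace_dim_def)
  then show "subspace_dim (b * q) (noise_space b q) = b * q - 2 * q"
    unfolding ker by (simp add: V.dim_is_n W.dim_is_n)
qed

section \<open>Comparison of the noise space with the eigenspace\<close>

lemma noise_space_subset_eigenspace:
  assumes "b \<ge> 2" "q \<ge> 3"
  shows "noise_space b q \<subseteq>
    eigenspace (normalized_adjacency (roc_adjacency b q)) (- 1 / (real b - 1))"
proof
  fix x assume x: "x \<in> noise_space b q"
  then show "x \<in> eigenspace (normalized_adjacency (roc_adjacency b q)) (- 1 / (real b - 1))"
    using assms by (subst roc_eigenspace_iff) (auto simp: noise_space_def)
qed

text \<open>The corners of an eigenvector solve the ring recurrence and hence vanish; the block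
  equation then leaves a nonzero multiple of the internal sum.\<close>

lemma eigenspace_subset_noise_space:
  assumes b: "b \<ge> 2" and q: "q \<ge> 3"
    and "\<not> (b = 2 \<and> even q)" and "\<not> (b = 3 \<and> 3 dvd q)"
  shows "eigenspace (normalized_adjacency (roc_adjacency b q)) (- 1 / (real b - 1)) \<subseteq>
    noise_space b q"
proof
  let ?A = "normalized_adjacency (roc_adjacency b q)"
  fix x assume x: "x \<in> eigenspace ?A (- 1 / (real b - 1))"
  have "dim_row ?A = b * q"
    using carrier_matD(1)[OF roc_adjacency_carrier, of b q]
    by (simp add: normalized_adjacency_def diag_inv_sqrt_def degree_matrix_def mat_diag_def)
  then have xc: "x \<in> carrier_vec (b * q)"
    using x by (simp add: eigenspace_def)
  note eqs = x[unfolded roc_eigenspace_iff[OF b q xc], rule_format]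
  have corner: "x $ corner b k = 0" if "k < q" for k
    using corner_recurrence_trivial[of b q "\<lambda>k. x $ corner b k" k] assms eqs that by auto
  moreover have "(\<Sum>i\<in>internal b k. x $ i) = 0" if "k < q" for k
    using eqs[OF that] corner[OF that] b by auto
  ultimately show "x \<in> noise_space b q"
    using xc by (simp add: noise_space_def)
qed

text \<open>From \<open>b = 3\<close> on, a block has two internal vertices, which can carry
  opposite values. For \<open>b = 2\<close> the single internal entry of each block is its own sum,
  so the noise space is zero.\<close>

lemma noise_space_nontrivial:
  assumes b: "b \<ge> 3" and q: "q > 0"
  shows "\<exists>x\<in>noise_space b q. x \<noteq> 0\<^sub>v (b * q)"
proof
  define x :: "real vec" where "x = unit_vec (b * q) 1 - unit_vec (b * q) 2"
  have bq: "2 < b * q"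
    using b q by (metis One_nat_def Suc_leI le_trans less_eq_Suc_le mult_le_mono mult.right_neutral
        numeral_2_eq_2 numeral_3_eq_3)
  have x: "x $ u = of_bool (u = 1) - of_bool (u = 2)" if "u < b * q" for u
    using that bq by (auto simp: x_def)
  have "x $ 1 \<noteq> 0"
    using x[of 1] bq by simp
  then show "x \<noteq> 0\<^sub>v (b * q)"
    using bq by auto
  have "x $ corner b k = 0" if "k < q" for k
    using x[OF corner_less[OF _ that]] b by (cases k) (auto simp: corner_def)
  moreover have "(\<Sum>i\<in>internal b k. x $ i) = 0" if "k < q" for k
  proof -
    have "(\<Sum>i\<in>internal b k. x $ i) =
        (\<Sum>i\<in>internal b k. (if i = 1 then 1 else 0) - (if i = 2 then 1 else 0))"
      using x internal_less[OF that] by (intro sum.cong) auto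
    also have "\<dots> = of_bool (1 \<in> internal b k) - of_bool (2 \<in> internal b k)"
      by (simp add: sum_subtractf internal_def)
    \<comment> \<open>Block 0 contains both vertices, and every later block starts beyond
      them.\<close>
    also have "1 \<in> internal b k \<longleftrightarrow> 2 \<in> internal b k"
      using b by (cases k) (auto simp: internal_def)
    finally show ?thesis
      by simp
  qed
  ultimately show "x \<in> noise_space b q"
    by (simp add: noise_space_def x_def)
qed

theorem theorem5:
  fixes b q n :: nat and A :: "real mat" and lam :: real
  assumes "b \<ge> 2" and "q \<ge> 3"
    and n: "n = b * q"
    and A: "A = normalized_adjacency (roc_adjacency b q)"
    and lam: "lam = - 1 / (real b - 1)"
  shows "\<exists>X. is_subspace n X
    \<and> X \<subseteq> eigenspace A lam
    \<and> subspace_dim n X = n - 2 * q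
    \<and> (\<not> (b = 2 \<and> even q) \<and> \<not> (b = 3 \<and> 3 dvd q) \<longrightarrow> X = eigenspace A lam)
    \<and> (b \<ge> 3 \<longrightarrow> eigenvalue A lam)
    \<and> (\<forall>x \<in> carrier_vec n.
          (\<forall>k<q. x $ corner b k = 0) \<and> (\<forall>k<q. (\<Sum>i\<in>internal b k. x $ i) = 0) \<longrightarrow> x \<in> X)"
proof (intro exI[of _ "noise_space b q"] conjI impI ballI)
  show sub: "noise_space b q \<subseteq> eigenspace A lam"
    unfolding A lam using assms by (intro noise_space_subset_eigenspace)
  show "is_subspace n (noise_space b q)" "subspace_dim n (noise_space b q) = n - 2 * q"
    unfolding n using noise_space_subspace_dim assms(1) by blast+
  show "noise_space b q = eigenspace A lam"
    if "\<not> (b = 2 \<and> even q) \<and> \<not> (b = 3 \<and> 3 dvd q)"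
    using sub that assms(1,2) eigenspace_subset_noise_space unfolding A lam by blast
  show "eigenvalue A lam" if b: "b \<ge> 3"
  proof -
    obtain x where x: "x \<in> noise_space b q" "x \<noteq> 0\<^sub>v (b * q)"
      using noise_space_nontrivial[OF b, of q] assms(2) by auto
    with sub have "x \<in> eigenspace A lam"
      by blast
    moreover have "x \<in> carrier_vec (b * q)"
      using x(1) unfolding noise_space_def by blast
    ultimately have "eigenvector A x lam"
      using x(2) unfolding eigenvector_def eigenspace_def
      by (metis (lifting) carrier_vecD mem_Collect_eq)
    then show ?thesis
      by (auto simp: eigenvalue_def)
  qed
  show "x \<in> noise_space b q" if "x \<in> carrier_vec n"
    "(\<forall>k<q. x $ corner b k = 0) \<and> (\<forall>k<q. (\<Sum>i\<in>internal b k. x $ i) = 0)" for x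
    using that by (simp add: noise_space_def n)
qed

end
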